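(* Fix $0<\alpha<1$. Let $J$ be the (fixed) involution on $\mathcal{H}_\alpha$ and $\mathcal{G}_\alpha=(\Pi_m)_{m\ge0}$ the (fixed) uniformly stable Galerkin hierarchy described in the context, and let $U_N\in\mathcal{H}_\alpha$ ($N\ge2$) be the targets described there. Then there is a constant $c_\alpha>0$, depending only on $\alpha$, such that for every integer $N\ge2$ $$\frac{\sum_{m=0}^{\infty}\|\Pi_{m+1}U_N-\Pi_mU_N\|^2}{\|U_N\|^2}\ge c_\alpha N^\alpha.$$ Each $U_N$ has finite support (it is a finite linear combination of the basis vectors $f_j$), but these full-tail ratios are not bounded uniformly in the target.
   Context: Let $\mathbb{T}=\mathbb{R}/\mathbb{Z}$ be represented by $(-\tfrac12,\tfrac12]$. For $0<\alpha<1$ let $w_\alpha(t)=|t|^\alpha$ and $H_\alpha=L^2(\mathbb{T},w_\alpha(t)\,dt;\mathbb{R})$. Let $(x_n)_{n\ge1}$ be the real trigonometric system $x_1=1$, $x_{2k}=\sqrt2\cos(2\pi kt)$, $x_{2k+1}=\sqrt2\sin(2\pi kt)$ ($k\ge1$), and $z_n=w_\alpha^{-1}x_n$. Both $(x_n)$ and $(z_n)$ are Schauder bases of $H_\alpha$. Let $\mathcal{H}_\alpha=H_\alpha\oplus H_\alpha$ (Hilbert direct sum), and $$f_{2n-1}=2^{-1/2}(x_n,z_n),\qquad f_{2n}=2^{-1/2}(x_n,-z_n)\qquad(n\ge1).$$ $(f_j)_{j\ge1}$ is a Schauder basis of $\mathcal{H}_\alpha$. Let $X_0=\{0\}$, $X_m=\operatorname{span}\{f_1,\dots,f_m\}$,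 $\Pi_0=0$, and let $\Pi_m:\mathcal{H}_\alpha\to X_m$ be the coordinate partial-sum projection of this basis ($m\ge1$); $\sup_m\|\Pi_m\|<\infty$. Let $J(u,v)=(v,u)$ on $\mathcal{H}_\alpha$, so $J=J^*=J^{-1}$. With respect to the bilinear form $a(U,V)=(JU,V)_{\mathcal{H}_\alpha}$, $\Pi_m$ is the Galerkin projection onto $X_m$, i.e. $a(U-\Pi_mU,V_m)=0$ for all $V_m\in X_m$, and the hierarchy is uniformly stable: $$\inf_{m\ge1}\ \inf_{0\ne U_m\in X_m}\ \sup_{0\ne V_m\in X_m}\frac{|(JU_m,V_m)|}{\|U_m\|\|V_m\|}>0.$$ For $N\ge2$ let $F_N(t)=\sum_{|k|<N}\bigl(1-\tfrac{|k|}{N}\bigr)e^{2\pi ikt}$ be the Fejér kernel, $q_N=F_N/\|F_N\|_{L^2(\mathbb{T})}$ (unweighted $L^2$ norm), and $U_N=(q_N,0)\in\mathcal{H}_\alpha$. *)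

theory Defs
  imports "HOL-Analysis.Analysis" "HOL-Library.Function_Algebras"
begin

section \<open>The weighted space \<open>H\<^sub>\<alpha>\<close> and the direct sum\<close>

text \<open>
  Elements of \<open>L\<^sup>2\<close> spaces are represented by real functions, of which only the values on
  the period \<open>(-1/2, 1/2]\<close> matter; functions that agree almost everywhere there stand for the same
  element, i.e. \<open>U\<close> and \<open>V\<close> are identified when \<open>U - V\<close> has norm 0.
\<close>

definition torus :: "real measure" where
  "torus = restrict_space lborel {-1/2<..1/2}"

definition weight :: "real \<Rightarrow> real \<Rightarrow> real" where
  "weight \<alpha> t = \<bar>t\<bar> powr \<alpha>"

definition wtorus :: "real \<Rightarrow> real measure" where
  "wtorus \<alpha> = density torus (\<lambda>t. ennreal (weight \<alpha> t))"

definition L2_inner :: "real measure \<Rightarrow> (real \<Rightarrow> real) \<Rightarrow> (real \<Rightarrow> real) \<Rightarrow> real" where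
  "L2_inner M u v = (\<integral>t. u t * v t \<partial>M)"

definition L2_norm :: "real measure \<Rightarrow> (real \<Rightarrow> real) \<Rightarrow> real" where
  "L2_norm M u = sqrt (L2_inner M u u)"

type_synonym pair_fun = "(real \<Rightarrow> real) \<times> (real \<Rightarrow> real)"

definition scale :: "real \<Rightarrow> pair_fun \<Rightarrow> pair_fun" where
  "scale c U = (\<lambda>t. c * fst U t, \<lambda>t. c * snd U t)"

definition inner_HH :: "real \<Rightarrow> pair_fun \<Rightarrow> pair_fun \<Rightarrow> real" where
  "inner_HH \<alpha> U V = L2_inner (wtorus \<alpha>) (fst U) (fst V) + L2_inner (wtorus \<alpha>) (snd U) (snd V)"

definition norm_HH :: "real \<Rightarrow> pair_fun \<Rightarrow> real" where
  "norm_HH \<alpha> U = sqrt (inner_HH \<alpha> U U)"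

section \<open>The bases\<close>

text \<open>The index starts at 1; \<open>trig 0\<close> is not used.\<close>

definition trig :: "nat \<Rightarrow> real \<Rightarrow> real" where
  "trig n t =
     (if n = 1 then 1
      else if even n then sqrt 2 * cos (2 * pi * real (n div 2) * t)
      else sqrt 2 * sin (2 * pi * real (n div 2) * t))"

text \<open>At the single point \<open>t = 0\<close> the quotient takes the value 0, which is irrelevant.\<close>

definition dual_trig :: "real \<Rightarrow> nat \<Rightarrow> real \<Rightarrow> real" where
  "dual_trig \<alpha> n t = trig n t / weight \<alpha> t"

text \<open>For \<open>j = 2n - 1\<close> and for \<open>j = 2n\<close> the number \<open>(j + 1) div 2\<close> is \<open>n\<close>.\<close>

definition basis :: "real \<Rightarrow> nat \<Rightarrow> pair_fun" where
  "basis \<alpha> j =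
     (let n = (j + 1) div 2 in
      scale (1 / sqrt 2) (trig n, if odd j then dual_trig \<alpha> n else - dual_trig \<alpha> n))"

definition lin_comb :: "real \<Rightarrow> (nat \<Rightarrow> real) \<Rightarrow> nat \<Rightarrow> pair_fun" where
  "lin_comb \<alpha> c m = (\<Sum>j=1..m. scale (c j) (basis \<alpha> j))"

definition X :: "real \<Rightarrow> nat \<Rightarrow> pair_fun set" where
  "X \<alpha> m = {lin_comb \<alpha> c m |c. True}"

text \<open>The coordinate sequence of \<open>U\<close>: the unique sequence whose expansion converges to
  \<open>U\<close> in norm. The condition \<open>c 0 = 0\<close> only fixes the value at the unused index 0.\<close>

definition coords :: "real \<Rightarrow> pair_fun \<Rightarrow> nat \<Rightarrow> real" where
  "coords \<alpha> U = (THE c. c 0 = 0 \<and> (\<lambda>m. norm_HH \<alpha> (U - lin_comb \<alpha> c m)) \<longlonglongrightarrow> 0)"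

definition Proj :: "real \<Rightarrow> nat \<Rightarrow> pair_fun \<Rightarrow> pair_fun" where
  "Proj \<alpha> m U = lin_comb \<alpha> (coords \<alpha> U) m"

section \<open>The involution, the bilinear form and Galerkin projections\<close>

definition J :: "pair_fun \<Rightarrow> pair_fun" where
  "J U = (snd U, fst U)"

definition form :: "real \<Rightarrow> pair_fun \<Rightarrow> pair_fun \<Rightarrow> real" where
  "form \<alpha> U V = inner_HH \<alpha> (J U) V"

definition is_Galerkin_projection :: "real \<Rightarrow> nat \<Rightarrow> pair_fun \<Rightarrow> pair_fun \<Rightarrow> bool" where
  "is_Galerkin_projection \<alpha> m U W \<longleftrightarrow> W \<in> X \<alpha> m \<and> (\<forall>V\<in>X \<alpha> m. form \<alpha> (U - W) V = 0)"

section \<open>The targets\<close>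

text \<open>The sum is real, since the terms for \<open>k\<close> and \<open>-k\<close> are conjugate; \<open>Re\<close> only changes the type.\<close>

definition fejer :: "nat \<Rightarrow> real \<Rightarrow> real" where
  "fejer N t =
     Re (\<Sum>k\<in>{k::int. \<bar>k\<bar> < int N}.
           complex_of_real (1 - \<bar>real_of_int k\<bar> / real N)
           * exp (2 * complex_of_real pi * \<i> * of_int k * complex_of_real t))"

definition q :: "nat \<Rightarrow> real \<Rightarrow> real" where
  "q N t = fejer N t / L2_norm torus (fejer N)"

definition target :: "nat \<Rightarrow> pair_fun" where
  "target N = (q N, \<lambda>t. 0)"

definition tail_term :: "real \<Rightarrow> pair_fun \<Rightarrow> nat \<Rightarrow> real" where
  "tail_term \<alpha> U m = (norm_HH \<alpha> (Proj \<alpha> (Suc m) U - Proj \<alpha> m U))\<^sup>2"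

definition tail_ratio :: "real \<Rightarrow> pair_fun \<Rightarrow> real" where
  "tail_ratio \<alpha> U = (\<Sum>m. tail_term \<alpha> U m) / (norm_HH \<alpha> U)\<^sup>2"

end

theory Submission
  imports Defs
begin

text \<open>
  The tail sum sees the coordinates of the target, and these are governed by the unweighted norm;
  the denominator is the weighted norm. The Fejer kernels drive the two norms apart, because they
  concentrate at the zero of the weight.

  In detail, the form \<open>form \<alpha>\<close> is diagonal on the basis with entries \<open>1\<close> and \<open>- 1\<close>
  (\<open>form_basis\<close>) and bounded by the norm. Hence coordinates are unique, every finite linear
  combination has its own coefficients as coordinates (\<open>coords_lin_comb\<close>), and partial sums are
  Galerkin projections (\<open>Proj_lin_comb_Galerkin\<close>).

  Write the unit vector \<open>q N\<close> of unweighted \<open>L\<^sup>2\<close> as the finite sum of \<open>a n * trig n\<close>. Then the target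
  \<open>(q N, 0)\<close> has the coordinates \<open>a n / sqrt 2\<close>, each taken twice. The large and opposite second
  components of the two basis vectors involved cancel in the target, but the tail sum counts
  their increments one after the other. Since every basis vector has squared norm at least
  \<open>1/2\<close>, the tail sum is at least half the square sum of the \<open>a n\<close>, that is \<open>1/2\<close>
  (\<open>tail_sum_lin_comb\<close>).

  For the denominator, \<open>\<bar>t\<bar> powr \<alpha> \<le> N powr - \<alpha> * (1 + (N * t)\<^sup>2)\<close> reduces the weighted norm of
  the kernel to its unweighted norm and its second moment. By \<open>4 * t\<^sup>2 \<le> (sin (pi * t))\<^sup>2\<close> the
  second moment is controlled by the square integral of \<open>sin (pi * t) * fejer N t\<close>. This product
  is the average of \<open>N\<close> orthogonal sines (\<open>sin_times_fejer\<close>), so the integral equals \<open>1 / (2 * N)\<close>.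
  The squared weighted norm of the target is therefore at most \<open>2 * N powr - \<alpha>\<close>, and the
  ratio is at least \<open>N powr \<alpha> / 4\<close>.
\<close>

section \<open>Square-integrable pairs and the bilinear form\<close>

definition square_integrable :: "real measure \<Rightarrow> (real \<Rightarrow> real) \<Rightarrow> bool" where
  "square_integrable M u \<longleftrightarrow> u \<in> borel_measurable M \<and> integrable M (\<lambda>t. (u t)\<^sup>2)"

lemma square_integrable_mult:
  assumes "square_integrable M u" "square_integrable M v"
  shows "integrable M (\<lambda>t. u t * v t)"
proof (rule Bochner_Integration.integrable_bound)
  show "integrable M (\<lambda>t. (u t)\<^sup>2 + (v t)\<^sup>2)"
    using assms by (simp add: square_integrable_def)
  show "(\<lambda>t. u t * v t) \<in> borel_measurable M"
    using assms by (auto simp: square_integrable_def)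
  have "\<bar>a * b\<bar> \<le> a\<^sup>2 + b\<^sup>2" for a b :: real
  proof -
    have "2 * (\<bar>a\<bar> * \<bar>b\<bar>) \<le> a\<^sup>2 + b\<^sup>2"
      using sum_squares_bound[of "\<bar>a\<bar>" "\<bar>b\<bar>"] by (simp add: mult.assoc)
    moreover have "0 \<le> \<bar>a\<bar> * \<bar>b\<bar>"
      by simp
    ultimately show ?thesis
      unfolding abs_mult by linarith
  qed
  then show "AE t in M. norm (u t * v t) \<le> norm ((u t)\<^sup>2 + (v t)\<^sup>2)"
    by simp
qed

lemma square_integrable_zero: "square_integrable M (\<lambda>t. 0)"
  by (simp add: square_integrable_def)

lemma square_integrable_add:
  assumes "square_integrable M u" "square_integrable M v"
  shows "square_integrable M (u + v)"
proof -
  have "integrable M (\<lambda>t. (u t)\<^sup>2 + (v t)\<^sup>2 + 2 * (u t * v t))"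
    using assms square_integrable_mult[OF assms] by (simp add: square_integrable_def)
  then have "integrable M (\<lambda>t. ((u + v) t)\<^sup>2)"
    by (simp add: power2_sum mult.assoc)
  moreover have "u + v \<in> borel_measurable M"
    using assms unfolding square_integrable_def plus_fun_def by (intro borel_measurable_add) auto
  ultimately show ?thesis
    by (simp add: square_integrable_def)
qed

lemma square_integrable_cmult:
  assumes "square_integrable M u"
  shows "square_integrable M (\<lambda>t. c * u t)"
  using assms by (auto simp: square_integrable_def power_mult_distrib)

lemma L2_inner_add_left:
  assumes "square_integrable M u" "square_integrable M v" "square_integrable M w"
  shows "L2_inner M (u + v) w = L2_inner M u w + L2_inner M v w"
  using square_integrable_mult[OF assms(1,3)] square_integrable_mult[OF assms(2,3)]
  by (simp add: L2_inner_def distrib_right)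

lemma L2_inner_cmult_left: "L2_inner M (\<lambda>t. c * u t) w = c * L2_inner M u w"
  by (simp add: L2_inner_def mult.assoc)

lemma L2_inner_commute: "L2_inner M u v = L2_inner M v u"
  by (simp add: L2_inner_def mult.commute)

text \<open>The integral of a non-integrable function is 0, so bilinearity and the Cauchy-Schwarz inequality
  hold only on the pairs of square-integrable functions.\<close>

definition HH :: "real \<Rightarrow> pair_fun set" where
  "HH \<alpha> = {U. square_integrable (wtorus \<alpha>) (fst U) \<and> square_integrable (wtorus \<alpha>) (snd U)}"

lemma HH_zero: "0 \<in> HH \<alpha>"
  using square_integrable_zero by (simp add: HH_def zero_fun_def)

lemma HH_add: "U \<in> HH \<alpha> \<Longrightarrow> V \<in> HH \<alpha> \<Longrightarrow> U + V \<in> HH \<alpha>"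
  by (simp add: HH_def square_integrable_add)

lemma HH_scale: "U \<in> HH \<alpha> \<Longrightarrow> scale c U \<in> HH \<alpha>"
  by (simp add: HH_def scale_def square_integrable_cmult)

lemma HH_sum: "(\<And>i. i \<in> A \<Longrightarrow> f i \<in> HH \<alpha>) \<Longrightarrow> sum f A \<in> HH \<alpha>"
  by (induction A rule: infinite_finite_induct) (auto simp: HH_zero HH_add)

lemma HH_J: "U \<in> HH \<alpha> \<Longrightarrow> J U \<in> HH \<alpha>"
  by (simp add: HH_def J_def)

lemma inner_HH_commute: "inner_HH \<alpha> U V = inner_HH \<alpha> V U"
  by (simp add: inner_HH_def L2_inner_commute)

lemma inner_HH_add_left:
  assumes "U \<in> HH \<alpha>" "V \<in> HH \<alpha>" "W \<in> HH \<alpha>"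
  shows "inner_HH \<alpha> (U + V) W = inner_HH \<alpha> U W + inner_HH \<alpha> V W"
  using assms by (simp add: HH_def inner_HH_def L2_inner_add_left)

lemma inner_HH_scale_left: "inner_HH \<alpha> (scale c U) W = c * inner_HH \<alpha> U W"
  by (simp add: inner_HH_def scale_def L2_inner_cmult_left distrib_left)

lemma inner_HH_nonneg: "0 \<le> inner_HH \<alpha> U U"
  by (simp add: inner_HH_def L2_inner_def)

text \<open>A positive semidefinite binary quadratic form has nonnegative discriminant; the form may be
  degenerate, so the case \<open>C = 0\<close> has to be allowed.\<close>

lemma quadratic_form_Cauchy_Schwarz:
  fixes A B C :: real
  assumes "\<And>r s. 0 \<le> r\<^sup>2 * A + 2 * r * s * B + s\<^sup>2 * C"
  shows "B\<^sup>2 \<le> A * C"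
proof (cases "C = 0")
  case True
  have "B = 0"
  proof (rule ccontr)
    assume "B \<noteq> 0"
    \<comment> \<open>For \<open>r = 1\<close> the form is affine in \<open>s\<close>; this \<open>s\<close> makes its value \<open>- 1\<close>.\<close>
    then have "A + 2 * (- (A + 1) / (2 * B)) * B = - 1"
      by (simp add: field_simps)
    then show False
      using assms[of 1 "- (A + 1) / (2 * B)"] True by simp
  qed
  then show ?thesis
    using True by simp
next
  case False
  have "0 \<le> C\<^sup>2 * A + 2 * C * (- B) * B + (- B)\<^sup>2 * C"
    by (rule assms)
  also have "\<dots> = C * (A * C - B\<^sup>2)"
    by (simp add: algebra_simps power2_eq_square)
  finally have "0 \<le> C * (A * C - B\<^sup>2)" .
  moreover have "0 < C"
    using assms[of 0 1] False by simp
  ultimately show ?thesis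
    by (simp add: zero_le_mult_iff)
qed

lemma inner_HH_Cauchy_Schwarz:
  assumes "U \<in> HH \<alpha>" "V \<in> HH \<alpha>"
  shows "\<bar>inner_HH \<alpha> U V\<bar> \<le> norm_HH \<alpha> U * norm_HH \<alpha> V"
proof -
  have "(inner_HH \<alpha> U V)\<^sup>2 \<le> inner_HH \<alpha> U U * inner_HH \<alpha> V V"
  proof (rule quadratic_form_Cauchy_Schwarz)
    fix r s
    have S: "scale r U \<in> HH \<alpha>" "scale s V \<in> HH \<alpha>"
      using assms by (auto intro: HH_scale)
    have expand: "inner_HH \<alpha> (scale r U + scale s V) W = r * inner_HH \<alpha> U W + s * inner_HH \<alpha> V W"
      if "W \<in> HH \<alpha>" for W
      using S that by (simp add: inner_HH_add_left inner_HH_scale_left)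
    have expand': "inner_HH \<alpha> W (scale r U + scale s V) = r * inner_HH \<alpha> W U + s * inner_HH \<alpha> W V"
      if "W \<in> HH \<alpha>" for W
      using expand[OF that] by (simp add: inner_HH_commute)
    have "0 \<le> inner_HH \<alpha> (scale r U + scale s V) (scale r U + scale s V)"
      by (rule inner_HH_nonneg)
    also have "\<dots> = r * inner_HH \<alpha> U (scale r U + scale s V)
        + s * inner_HH \<alpha> V (scale r U + scale s V)"
      by (intro expand HH_add S)
    also have "\<dots> = r\<^sup>2 * inner_HH \<alpha> U U + 2 * r * s * inner_HH \<alpha> U V + s\<^sup>2 * inner_HH \<alpha> V V"
      using assms by (simp add: expand' inner_HH_commute[of \<alpha> V U] algebra_simps power2_eq_square)
    finally show "0 \<le> r\<^sup>2 * inner_HH \<alpha> U U + 2 * r * s * inner_HH \<alpha> U V + s\<^sup>2 * inner_HH \<alpha> V V" .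
  qed
  then have "sqrt ((inner_HH \<alpha> U V)\<^sup>2) \<le> sqrt (inner_HH \<alpha> U U * inner_HH \<alpha> V V)"
    by (rule real_sqrt_le_mono)
  then show ?thesis
    by (simp add: norm_HH_def real_sqrt_mult)
qed

lemma J_add: "J (U + V) = J U + J V"
  by (simp add: J_def plus_prod_def)

lemma J_scale: "J (scale c U) = scale c (J U)"
  by (simp add: J_def scale_def)

lemma form_add_left:
  assumes "U \<in> HH \<alpha>" "V \<in> HH \<alpha>" "W \<in> HH \<alpha>"
  shows "form \<alpha> (U + V) W = form \<alpha> U W + form \<alpha> V W"
  using assms by (simp add: form_def J_add inner_HH_add_left HH_J)

lemma form_scale_left: "form \<alpha> (scale c U) W = c * form \<alpha> U W"
  by (simp add: form_def J_scale inner_HH_scale_left)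

lemma form_commute: "form \<alpha> U V = form \<alpha> V U"
  by (simp add: form_def inner_HH_def J_def L2_inner_commute)

lemma form_zero_left: "form \<alpha> 0 V = 0"
  by (simp add: form_def inner_HH_def J_def L2_inner_def)

lemma form_sum_left:
  assumes "\<And>i. i \<in> A \<Longrightarrow> f i \<in> HH \<alpha>" "W \<in> HH \<alpha>"
  shows "form \<alpha> (sum f A) W = (\<Sum>i\<in>A. form \<alpha> (f i) W)"
  using assms
  by (induction A rule: infinite_finite_induct) (auto simp: form_zero_left form_add_left HH_sum)

lemma diff_eq_add_scale: "U - V = U + scale (- 1) V"
  by (simp add: scale_def prod_eq_iff fun_eq_iff)

lemma HH_diff: "U \<in> HH \<alpha> \<Longrightarrow> V \<in> HH \<alpha> \<Longrightarrow> U - V \<in> HH \<alpha>"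
  by (simp add: diff_eq_add_scale HH_add HH_scale)

lemma form_diff_left:
  assumes "U \<in> HH \<alpha>" "V \<in> HH \<alpha>" "W \<in> HH \<alpha>"
  shows "form \<alpha> (U - V) W = form \<alpha> U W - form \<alpha> V W"
  using assms by (simp add: diff_eq_add_scale form_add_left HH_scale form_scale_left)

text \<open>The involution is isometric, so boundedness of the form is the Cauchy-Schwarz inequality. This is
  what makes coordinates, read off by the form, continuous in the norm.\<close>

lemma form_bounded:
  assumes "U \<in> HH \<alpha>" "V \<in> HH \<alpha>"
  shows "\<bar>form \<alpha> U V\<bar> \<le> norm_HH \<alpha> U * norm_HH \<alpha> V"
proof -
  have "norm_HH \<alpha> (J U) = norm_HH \<alpha> U"
    by (simp add: norm_HH_def inner_HH_def J_def)
  then show ?thesis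
    using inner_HH_Cauchy_Schwarz[OF HH_J[OF assms(1)] assms(2)] by (simp add: form_def)
qed

section \<open>Orthonormality of the trigonometric system\<close>

lemma torus_measurable:
  fixes f :: "real \<Rightarrow> real"
  shows "f \<in> borel_measurable borel \<Longrightarrow> f \<in> borel_measurable torus"
  unfolding torus_def by (intro measurable_restrict_space1) simp

lemma AE_torus: "AE t in torus. - 1/2 < t \<and> t \<le> 1/2 \<and> t \<noteq> 0"
proof -
  have "AE t in lborel. t \<in> {- 1/2<..1/2} \<longrightarrow> - 1/2 < t \<and> t \<le> 1/2 \<and> t \<noteq> (0::real)"
    using AE_lborel_singleton[of "0::real"] by eventually_elim auto
  then show ?thesis
    unfolding torus_def by (subst AE_restrict_space_iff) auto
qed

lemma finite_measure_torus: "finite_measure torus"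
  by (intro finite_measureI) (simp add: torus_def emeasure_restrict_space space_restrict_space)

lemma torus_integrable_bounded:
  fixes f :: "real \<Rightarrow> real"
  assumes "f \<in> borel_measurable borel" "\<And>t. \<bar>t\<bar> \<le> 1/2 \<Longrightarrow> \<bar>f t\<bar> \<le> B"
  shows "integrable torus f"
proof (rule finite_measure.integrable_const_bound[OF finite_measure_torus])
  show "AE t in torus. norm (f t) \<le> B"
    using AE_torus by eventually_elim (auto intro!: assms(2))
qed (rule torus_measurable[OF assms(1)])

text \<open>The half-open period differs from the closed interval of the fundamental theorem of calculus by
  one point.\<close>

lemma has_bochner_integral_torus_FTC:
  fixes F f :: "real \<Rightarrow> real"
  assumes F: "\<And>t. (F has_real_derivative f t) (at t)" and f: "continuous_on UNIV f"
  shows "has_bochner_integral torus f (F (1/2) - F (- 1/2))"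
proof -
  have "has_bochner_integral lborel (\<lambda>t. f t * indicator {- 1/2..1/2} t) (F (1/2) - F (- 1/2))"
    using f
    by (intro has_bochner_integral_FTC_Icc_real F) (auto simp: continuous_on_eq_continuous_at)
  then have "has_bochner_integral lborel (\<lambda>t. indicator {- 1/2<..1/2} t *\<^sub>R f t)
      (F (1/2) - F (- 1/2))"
  proof (subst has_bochner_integral_cong_AE)
    show "AE t in lborel. indicator {- 1/2<..1/2} t *\<^sub>R f t = f t * indicator {- 1/2..1/2} t"
      using AE_lborel_singleton[of "- 1/2::real"]
      by eventually_elim (auto simp: indicator_def)
    have "f \<in> borel_measurable borel"
      using f by (rule borel_measurable_continuous_onI)
    then show "(\<lambda>t. indicator {- 1/2<..1/2} t *\<^sub>R f t) \<in> borel_measurable lborel"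
      "(\<lambda>t. f t * indicator {- 1/2..1/2} t) \<in> borel_measurable lborel"
      by measurable
  qed
  then show ?thesis
    by (simp add: torus_def has_bochner_integral_restrict_space)
qed

lemma has_bochner_integral_torus_cos:
  fixes k :: int
  shows "has_bochner_integral torus (\<lambda>t. cos (2 * pi * of_int k * t)) (if k = 0 then 1 else 0)"
proof (cases "k = 0")
  case True
  have "has_bochner_integral torus (\<lambda>t. 1) (1/2 - (- 1/2 :: real))"
    by (rule has_bochner_integral_torus_FTC) (auto intro!: derivative_eq_intros)
  then show ?thesis
    using True by simp
next
  case False
  have "has_bochner_integral torus (\<lambda>t. cos (2 * pi * of_int k * t))
      (sin (2 * pi * of_int k * (1/2)) / (2 * pi * of_int k)
        - sin (2 * pi * of_int k * (- 1/2)) / (2 * pi * of_int k))"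
    using False
    by (intro has_bochner_integral_torus_FTC) (auto intro!: derivative_eq_intros continuous_intros)
  moreover have "sin (2 * pi * of_int k * (1/2)) = 0"
    by (simp add: sin_npi_int)
  moreover have "sin (2 * pi * of_int k * (- 1/2)) = 0"
    using sin_npi_int[of k] by simp
  ultimately show ?thesis
    using False by simp
qed

lemma has_bochner_integral_torus_sin:
  fixes k :: int
  shows "has_bochner_integral torus (\<lambda>t. sin (2 * pi * of_int k * t)) 0"
proof (cases "k = 0")
  case True
  then show ?thesis
    by (simp add: has_bochner_integral_zero)
next
  case False
  have "has_bochner_integral torus (\<lambda>t. sin (2 * pi * of_int k * t))
      (- cos (2 * pi * of_int k * (1/2)) / (2 * pi * of_int k)
        - (- cos (2 * pi * of_int k * (- 1/2)) / (2 * pi * of_int k)))"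
    using False
    by (intro has_bochner_integral_torus_FTC) (auto intro!: derivative_eq_intros continuous_intros)
  then show ?thesis
    by simp
qed

lemma has_bochner_integral_torus_half_diff:
  assumes "has_bochner_integral torus f a" "has_bochner_integral torus g b"
  shows "has_bochner_integral torus (\<lambda>t. (f t - g t) / 2) ((a - b) / (2::real))"
  using assms by (intro has_bochner_integral_divide_zero has_bochner_integral_diff) auto

lemma has_bochner_integral_torus_half_add:
  assumes "has_bochner_integral torus f a" "has_bochner_integral torus g b"
  shows "has_bochner_integral torus (\<lambda>t. (f t + g t) / 2) ((a + b) / (2::real))"
  using assms by (intro has_bochner_integral_divide_zero has_bochner_integral_add) auto

lemma has_bochner_integral_torus_cos_cos:
  fixes j k :: nat
  shows "has_bochner_integral torus
    (\<lambda>t. cos (2 * pi * real j * t) * cos (2 * pi * real k * t))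
    (((if j = k then 1 else 0) + (if j + k = 0 then 1 else 0)) / 2)"
proof -
  have *: "cos (2 * pi * real j * t) * cos (2 * pi * real k * t) =
      (cos (2 * pi * of_int (int j - int k) * t) + cos (2 * pi * of_int (int j + int k) * t)) / 2"
    for t
    by (simp add: cos_times_cos algebra_simps)
  have indices: "(int j - int k = 0) = (j = k)" "(int j + int k = 0) = (j + k = 0)"
    by auto
  show ?thesis
    using has_bochner_integral_torus_half_add[OF has_bochner_integral_torus_cos[of "int j - int k"]
        has_bochner_integral_torus_cos[of "int j + int k"]]
    by (simp only: * indices)
qed

lemma has_bochner_integral_torus_sin_sin:
  fixes j k :: nat
  shows "has_bochner_integral torus
    (\<lambda>t. sin (2 * pi * real j * t) * sin (2 * pi * real k * t))
    (((if j = k then 1 else 0) - (if j + k = 0 then 1 else 0)) / 2)"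
proof -
  have *: "sin (2 * pi * real j * t) * sin (2 * pi * real k * t) =
      (cos (2 * pi * of_int (int j - int k) * t) - cos (2 * pi * of_int (int j + int k) * t)) / 2"
    for t
    by (simp add: sin_times_sin algebra_simps)
  have indices: "(int j - int k = 0) = (j = k)" "(int j + int k = 0) = (j + k = 0)"
    by auto
  show ?thesis
    using has_bochner_integral_torus_half_diff[OF has_bochner_integral_torus_cos[of "int j - int k"]
        has_bochner_integral_torus_cos[of "int j + int k"]]
    by (simp only: * indices)
qed

lemma has_bochner_integral_torus_sin_cos:
  fixes j k :: nat
  shows "has_bochner_integral torus
    (\<lambda>t. sin (2 * pi * real j * t) * cos (2 * pi * real k * t)) 0"
proof -
  have *: "sin (2 * pi * real j * t) * cos (2 * pi * real k * t) =
      (sin (2 * pi * of_int (int j + int k) * t) + sin (2 * pi * of_int (int j - int k) * t)) / 2"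
    for t
    by (simp add: sin_times_cos distrib_left distrib_right left_diff_distrib right_diff_distrib)
  show ?thesis
    using has_bochner_integral_torus_half_add[OF has_bochner_integral_torus_sin[of "int j + int k"]
        has_bochner_integral_torus_sin[of "int j - int k"]]
    by (simp only: * add_0 div_0)
qed

text \<open>One formula for all indices: for \<open>n = 1\<close> the frequency \<open>n div 2\<close> is 0, so the constant is a cosine,
  but without the factor \<open>sqrt 2\<close>.\<close>

lemma trig_eq:
  "trig n t = (if n = 1 then 1 else sqrt 2) *
    (if n = 1 \<or> even n then cos (2 * pi * real (n div 2) * t) else sin (2 * pi * real (n div 2) * t))"
  by (simp add: trig_def)

lemma trig_orthonormal:
  assumes "1 \<le> m" "1 \<le> n"
  shows "has_bochner_integral torus (\<lambda>t. trig m t * trig n t) (if m = n then 1 else 0)"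
proof -
  define c where "c k = (if k = 1 then 1 else sqrt 2)" for k :: nat
  define e where "e k t = (if k = 1 \<or> even k then cos (2 * pi * real (k div 2) * t)
    else sin (2 * pi * real (k div 2) * t))" for k :: nat and t
  have *: "trig m t * trig n t = (c m * c n) * (e m t * e n t)" for t
    unfolding trig_eq c_def[symmetric] e_def[symmetric] by simp
  consider "m = 1 \<or> even m" "n = 1 \<or> even n" | "m \<noteq> 1 \<and> odd m" "n \<noteq> 1 \<and> odd n"
    | "m \<noteq> 1 \<and> odd m" "n = 1 \<or> even n" | "m = 1 \<or> even m" "n \<noteq> 1 \<and> odd n"
    by blast
  then show ?thesis
  proof cases
    case 1
    have "has_bochner_integral torus (\<lambda>t. (c m * c n) * (e m t * e n t))
      (c m * c n * (((if m div 2 = n div 2 then 1 else 0) + (if m div 2 + n div 2 = 0 then 1 else 0)) / 2))"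
      unfolding e_def using 1
      by (simp only: if_True simp_thms) (intro has_bochner_integral_mult_right has_bochner_integral_torus_cos_cos)
    moreover have "c m * c n * (((if m div 2 = n div 2 then 1 else 0) + (if m div 2 + n div 2 = 0 then 1 else 0)) / 2)
        = (if m = n then 1 else 0)"
      using 1 assms by (auto simp: c_def elim!: evenE)
    ultimately show ?thesis
      unfolding * by simp
  next
    case 2
    have "has_bochner_integral torus (\<lambda>t. (c m * c n) * (e m t * e n t))
      (c m * c n * (((if m div 2 = n div 2 then 1 else 0) - (if m div 2 + n div 2 = 0 then 1 else 0)) / 2))"
      unfolding e_def using 2
      by (simp only: if_False simp_thms) (intro has_bochner_integral_mult_right has_bochner_integral_torus_sin_sin)
    moreover have "c m * c n * (((if m div 2 = n div 2 then 1 else 0) - (if m div 2 + n div 2 = 0 then 1 else 0)) / 2)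
        = (if m = n then 1 else 0)"
      using 2 assms by (auto simp: c_def elim!: oddE)
    ultimately show ?thesis
      unfolding * by simp
  next
    case 3
    have "has_bochner_integral torus (\<lambda>t. (c m * c n) * (e m t * e n t)) (c m * c n * 0)"
      unfolding e_def using 3
      by (simp only: if_True if_False simp_thms) (intro has_bochner_integral_mult_right has_bochner_integral_torus_sin_cos)
    moreover have "m \<noteq> n"
      using 3 by auto
    ultimately show ?thesis
      unfolding * by simp
  next
    case 4
    have "has_bochner_integral torus (\<lambda>t. (c m * c n) * (e n t * e m t)) (c m * c n * 0)"
      unfolding e_def using 4
      by (simp only: if_True if_False simp_thms) (intro has_bochner_integral_mult_right has_bochner_integral_torus_sin_cos)
    moreover have "m \<noteq> n"
      using 4 by auto
    ultimately show ?thesis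
      unfolding * by (simp add: mult.commute[of "e n _"])
  qed
qed

text \<open>Parseval for a finite orthogonal family whose members all have the square norm \<open>d\<close>. The value
  \<open>d = 1\<close> serves the trigonometric system and \<open>d = 1/2\<close> the sines of half-integer frequency.\<close>

lemma has_bochner_integral_square_of_orthogonal_sum:
  fixes e :: "'i \<Rightarrow> 'a \<Rightarrow> real"
  assumes "finite A"
    and "\<And>i j. i \<in> A \<Longrightarrow> j \<in> A \<Longrightarrow>
      has_bochner_integral M (\<lambda>t. e i t * e j t) (if i = j then d else 0)"
  shows "has_bochner_integral M (\<lambda>t. (\<Sum>i\<in>A. a i * e i t)\<^sup>2) (d * (\<Sum>i\<in>A. (a i)\<^sup>2))"
proof -
  have "has_bochner_integral M (\<lambda>t. \<Sum>i\<in>A. \<Sum>j\<in>A. (a i * a j) * (e i t * e j t))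
      (\<Sum>i\<in>A. \<Sum>j\<in>A. (a i * a j) * (if i = j then d else 0))"
    using assms by (intro has_bochner_integral_sum has_bochner_integral_mult_right) auto
  moreover have "(\<Sum>i\<in>A. a i * e i t)\<^sup>2 = (\<Sum>i\<in>A. \<Sum>j\<in>A. (a i * a j) * (e i t * e j t))" for t
    by (simp add: power2_eq_square sum_product mult_ac)
  moreover have "(\<Sum>i\<in>A. \<Sum>j\<in>A. (a i * a j) * (if i = j then d else 0)) = d * (\<Sum>i\<in>A. (a i)\<^sup>2)"
    using assms(1) by (simp add: power2_eq_square sum_distrib_left mult_ac if_distrib[of "(*) _"] cong: if_cong)
  ultimately show ?thesis
    by simp
qed

section \<open>Orthogonality of the basis with respect to the bilinear form\<close>

lemma trig_abs_le: "\<bar>trig n t\<bar> \<le> sqrt 2"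
proof -
  have "\<bar>sqrt 2 * cos x\<bar> \<le> sqrt 2" "\<bar>sqrt 2 * sin x\<bar> \<le> sqrt 2" for x :: real
    by (simp_all add: abs_mult)
  then show ?thesis
    by (simp add: trig_def)
qed

lemma trig_measurable [measurable]: "trig n \<in> borel_measurable borel"
proof -
  have "trig n = (\<lambda>t. if n = 1 then 1 else if even n then sqrt 2 * cos (2 * pi * real (n div 2) * t)
      else sqrt 2 * sin (2 * pi * real (n div 2) * t))"
    by (simp add: trig_def fun_eq_iff)
  then show ?thesis
    by simp
qed

lemma weight_measurable [measurable]: "weight \<alpha> \<in> borel_measurable borel"
  unfolding weight_def[abs_def] by measurable

lemma dual_trig_measurable [measurable]: "dual_trig \<alpha> n \<in> borel_measurable borel"
  unfolding dual_trig_def[abs_def] by measurable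

lemma weight_nonneg: "0 \<le> weight \<alpha> t"
  by (simp add: weight_def)

lemma weight_pos: "t \<noteq> 0 \<Longrightarrow> 0 < weight \<alpha> t"
  by (simp add: weight_def)

lemma weight_le_1:
  assumes "0 < \<alpha>" "\<bar>t\<bar> \<le> 1/2"
  shows "weight \<alpha> t \<le> 1"
  using assms by (simp add: weight_def powr_le1)

text \<open>The singularity \<open>\<bar>t\<bar> powr - \<alpha>\<close> is integrable because \<open>\<alpha> < 1\<close>. Hence the functions
  \<open>dual_trig\<close> have finite norm in the weighted space.\<close>

lemma integrable_inverse_weight:
  assumes "\<alpha> < 1"
  shows "integrable torus (\<lambda>t. 1 / weight \<alpha> t)"
proof -
  define g where "g t = indicator {0..1/2} t *\<^sub>R (t powr (- \<alpha>))" for t :: real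
  have [measurable]: "g \<in> borel_measurable borel"
    unfolding g_def by measurable
  have "(\<lambda>t. t powr (- \<alpha>)) absolutely_integrable_on {0..1/2}"
    using assms by (intro nonnegative_absolutely_integrable_1 integrable_on_powr_from_0) auto
  then have g: "integrable lborel g"
    by (simp add: set_integrable_def g_def[abs_def] integrable_completion)
  have g': "integrable lborel (\<lambda>t. g (- t))"
    using lborel_integrable_real_affine[OF g, of "- 1" 0] by simp
  have "integrable lborel (\<lambda>t. indicator {- 1/2<..1/2} t *\<^sub>R (1 / weight \<alpha> t))"
  proof (rule Bochner_Integration.integrable_bound)
    show "integrable lborel (\<lambda>t. g t + g (- t))"
      using g g' by simp
    have "norm (indicator {- 1/2<..1/2} t *\<^sub>R (1 / weight \<alpha> t)) \<le> norm (g t + g (- t))" for t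
    proof -
      consider "t < 0" | "t = 0" | "0 < t"
        by linarith
      then show ?thesis
        by cases (auto simp: g_def weight_def indicator_def powr_minus_divide)
    qed
    then show "AE t in lborel. norm (indicator {- 1/2<..1/2} t *\<^sub>R (1 / weight \<alpha> t)) \<le> norm (g t + g (- t))"
      by simp
  qed measurable
  then show ?thesis
    by (simp add: torus_def integrable_restrict_space)
qed

lemma L2_inner_wtorus:
  assumes [measurable]: "u \<in> borel_measurable borel" "v \<in> borel_measurable borel"
  shows "L2_inner (wtorus \<alpha>) u v = (\<integral>t. weight \<alpha> t * (u t * v t) \<partial>torus)"
  unfolding L2_inner_def wtorus_def
  by (subst integral_density) (auto intro!: torus_measurable simp: weight_nonneg)

lemma square_integrable_wtorus:
  assumes [measurable]: "u \<in> borel_measurable borel"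
    and "integrable torus (\<lambda>t. weight \<alpha> t * (u t)\<^sup>2)"
  shows "square_integrable (wtorus \<alpha>) u"
proof -
  have "integrable (wtorus \<alpha>) (\<lambda>t. (u t)\<^sup>2)"
    unfolding wtorus_def using assms(2)
    by (subst integrable_density) (auto intro!: torus_measurable simp: weight_nonneg)
  moreover have "u \<in> borel_measurable (wtorus \<alpha>)"
    using torus_measurable[OF assms(1)] by (simp add: wtorus_def)
  ultimately show ?thesis
    by (simp add: square_integrable_def)
qed

lemma square_integrable_bounded:
  assumes "0 < \<alpha>" and [measurable]: "u \<in> borel_measurable borel" and u: "\<And>t. \<bar>u t\<bar> \<le> B"
  shows "square_integrable (wtorus \<alpha>) u"
proof (rule square_integrable_wtorus)
  show "integrable torus (\<lambda>t. weight \<alpha> t * (u t)\<^sup>2)"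
  proof (rule torus_integrable_bounded)
    fix t :: real assume "\<bar>t\<bar> \<le> 1/2"
    then have "weight \<alpha> t * (u t)\<^sup>2 \<le> 1 * B\<^sup>2"
      using assms(1) u[of t] power_mono[of "\<bar>u t\<bar>" B 2] by (intro mult_mono weight_le_1) auto
    then show "\<bar>weight \<alpha> t * (u t)\<^sup>2\<bar> \<le> B\<^sup>2"
      by (simp add: weight_nonneg)
  qed measurable
qed measurable

lemma square_integrable_trig:
  assumes "0 < \<alpha>"
  shows "square_integrable (wtorus \<alpha>) (trig n)"
  using assms by (rule square_integrable_bounded) (auto intro: trig_abs_le)

lemma weight_dual_trig_square: "weight \<alpha> t * (dual_trig \<alpha> n t)\<^sup>2 = (trig n t)\<^sup>2 / weight \<alpha> t"
  by (simp add: dual_trig_def power2_eq_square)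

lemma integrable_dual_trig_square:
  assumes "\<alpha> < 1"
  shows "integrable torus (\<lambda>t. weight \<alpha> t * (dual_trig \<alpha> n t)\<^sup>2)"
  unfolding weight_dual_trig_square
proof (rule Bochner_Integration.integrable_bound)
  show "integrable torus (\<lambda>t. 2 * (1 / weight \<alpha> t))"
    using integrable_inverse_weight[OF assms] by (rule integrable_mult_right)
  show "(\<lambda>t. (trig n t)\<^sup>2 / weight \<alpha> t) \<in> borel_measurable torus"
    by (intro torus_measurable) measurable
  have "(trig n t)\<^sup>2 / weight \<alpha> t \<le> 2 / weight \<alpha> t" for t
  proof -
    have "(trig n t)\<^sup>2 \<le> (sqrt 2)\<^sup>2"
      using trig_abs_le[of n t] by (intro power2_le_iff_abs_le[THEN iffD2]) auto
    then show ?thesis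
      by (intro divide_right_mono) (auto simp: weight_nonneg)
  qed
  then show "AE t in torus. norm ((trig n t)\<^sup>2 / weight \<alpha> t) \<le> norm (2 * (1 / weight \<alpha> t))"
    by (simp add: weight_nonneg)
qed

lemma square_integrable_dual_trig:
  assumes "\<alpha> < 1"
  shows "square_integrable (wtorus \<alpha>) (dual_trig \<alpha> n)"
  using integrable_dual_trig_square[OF assms] by (intro square_integrable_wtorus) measurable

lemma basis_eq:
  "basis \<alpha> j = ((\<lambda>t. 1 / sqrt 2 * trig ((j + 1) div 2) t),
    (\<lambda>t. (if odd j then 1 else - 1) / sqrt 2 * dual_trig \<alpha> ((j + 1) div 2) t))"
  by (simp add: basis_def scale_def Let_def)

lemma basis_in_HH:
  assumes "0 < \<alpha>" "\<alpha> < 1"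
  shows "basis \<alpha> j \<in> HH \<alpha>"
  using assms
  by (simp add: HH_def basis_eq square_integrable_cmult square_integrable_trig square_integrable_dual_trig
      del: times_divide_eq_left)

text \<open>The weight of the measure cancels the inverse weight in \<open>dual_trig\<close>, which leaves the unweighted
  orthonormality.\<close>

lemma trig_dual_trig_biorthogonal:
  assumes "1 \<le> m" "1 \<le> n"
  shows "L2_inner (wtorus \<alpha>) (trig m) (dual_trig \<alpha> n) = (if m = n then 1 else 0)"
proof -
  have "L2_inner (wtorus \<alpha>) (trig m) (dual_trig \<alpha> n)
      = (\<integral>t. weight \<alpha> t * (trig m t * dual_trig \<alpha> n t) \<partial>torus)"
    by (rule L2_inner_wtorus) measurable
  also have "\<dots> = (\<integral>t. trig m t * trig n t \<partial>torus)"
  proof (rule integral_cong_AE)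
    show "AE t in torus. weight \<alpha> t * (trig m t * dual_trig \<alpha> n t) = trig m t * trig n t"
      using AE_torus
    proof eventually_elim
      case (elim t)
      then show ?case
        using weight_pos[of t \<alpha>] by (simp add: dual_trig_def)
    qed
  qed (auto intro!: torus_measurable)
  also have "\<dots> = (if m = n then 1 else 0)"
    using trig_orthonormal[OF assms] by (simp add: has_bochner_integral_iff)
  finally show ?thesis .
qed

lemma L2_inner_cmult_right: "L2_inner M u (\<lambda>t. c * v t) = c * L2_inner M u v"
  by (simp add: L2_inner_commute[of M u] L2_inner_cmult_left)

text \<open>The basis is orthogonal for the indefinite form, with signature alternating between \<open>1\<close> and \<open>- 1\<close>:
  exchanging the components pairs each \<open>trig\<close> with a \<open>dual_trig\<close>, and the two members with the same
  \<open>n\<close> are separated by the sign of their second components. This explains both why coordinates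
  are given by the form and why the partial sums are Galerkin projections.\<close>

lemma form_basis:
  assumes "1 \<le> i" "1 \<le> j"
  shows "form \<alpha> (basis \<alpha> i) (basis \<alpha> j) = (if i = j then if odd j then 1 else - 1 else 0)"
proof -
  define m n :: nat where "m = (i + 1) div 2" and "n = (j + 1) div 2"
  define a b :: real where "a = (if odd i then 1 else - 1)" and "b = (if odd j then 1 else - 1)"
  define \<delta> :: real where "\<delta> = (if m = n then 1 else 0)"
  have mn: "1 \<le> m" "1 \<le> n"
    using assms by (auto simp: m_def n_def)
  \<comment> \<open>Each of the two summands carries the sign of one of the basis vectors, so for \<open>m = n\<close> opposite
    signs cancel and equal ones add up.\<close>
  have "form \<alpha> (basis \<alpha> i) (basis \<alpha> j) =
      L2_inner (wtorus \<alpha>) (\<lambda>t. a / sqrt 2 * dual_trig \<alpha> m t) (\<lambda>t. 1 / sqrt 2 * trig n t)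
      + L2_inner (wtorus \<alpha>) (\<lambda>t. 1 / sqrt 2 * trig m t) (\<lambda>t. b / sqrt 2 * dual_trig \<alpha> n t)"
    unfolding form_def inner_HH_def J_def basis_eq a_def b_def m_def n_def by simp
  also have "\<dots> = a / sqrt 2 * (1 / sqrt 2 * \<delta>) + 1 / sqrt 2 * (b / sqrt 2 * \<delta>)"
    unfolding L2_inner_cmult_left L2_inner_cmult_right \<delta>_def
    using trig_dual_trig_biorthogonal[OF mn] trig_dual_trig_biorthogonal[OF mn(2,1)]
    by (simp add: L2_inner_commute[of _ "dual_trig \<alpha> m"] eq_commute[of n m] del: times_divide_eq_left)
  also have "\<dots> = (a + b) / 2 * \<delta>"
    by (simp add: field_simps)
  also have "\<dots> = (if i = j then if odd j then 1 else - 1 else 0)"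
    using assms by (auto simp: a_def b_def \<delta>_def m_def n_def elim!: oddE evenE)
  finally show ?thesis .
qed

section \<open>Coordinates, Galerkin projections and tails of finite combinations\<close>

lemma lin_comb_in_HH:
  assumes "0 < \<alpha>" "\<alpha> < 1"
  shows "lin_comb \<alpha> c m \<in> HH \<alpha>"
  unfolding lin_comb_def by (intro HH_sum HH_scale basis_in_HH assms)

lemma form_lin_comb_basis:
  assumes "0 < \<alpha>" "\<alpha> < 1" "1 \<le> j"
  shows "form \<alpha> (lin_comb \<alpha> c m) (basis \<alpha> j) =
    (if j \<le> m then (if odd j then 1 else - 1) * c j else 0)"
proof -
  have "form \<alpha> (lin_comb \<alpha> c m) (basis \<alpha> j) = (\<Sum>i=1..m. c i * form \<alpha> (basis \<alpha> i) (basis \<alpha> j))"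
    unfolding lin_comb_def
    by (simp add: form_sum_left HH_scale basis_in_HH assms form_scale_left)
  also have "\<dots> = (\<Sum>i=1..m. if i = j then (if odd j then 1 else - 1) * c j else 0)"
    using assms(3) by (intro sum.cong refl) (auto simp: form_basis)
  also have "\<dots> = (if j \<le> m then (if odd j then 1 else - 1) * c j else 0)"
    using assms(3) by (subst sum.delta) auto
  finally show ?thesis .
qed

lemma lin_comb_eq_of_support:
  assumes "{j. c j \<noteq> 0} \<subseteq> {1..M}" "M \<le> m"
  shows "lin_comb \<alpha> c m = lin_comb \<alpha> c M"
proof -
  have vanish: "c j = 0" if "M < j" for j
    using assms(1) that by fastforce
  have scale_0: "scale 0 U = 0" for U
    by (simp add: scale_def zero_prod_def zero_fun_def)
  then show ?thesis
    unfolding lin_comb_def using assms by (intro sum.mono_neutral_right) (auto simp: vanish scale_0)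
qed

text \<open>Uniqueness of the expansion: if the partial sums of \<open>d\<close> also converge to the vector, then testing
  the error against \<open>basis \<alpha> j\<close> gives \<open>\<bar>c j - d j\<bar>\<close> for all large \<open>m\<close>, while boundedness of the form
  makes it tend to 0.\<close>

lemma coords_lin_comb:
  assumes \<alpha>: "0 < \<alpha>" "\<alpha> < 1" and c: "{j. c j \<noteq> 0} \<subseteq> {1..M}"
  shows "coords \<alpha> (lin_comb \<alpha> c M) = c"
  unfolding coords_def
proof (rule the_equality)
  have "norm_HH \<alpha> (lin_comb \<alpha> c M - lin_comb \<alpha> c m) = 0" if "M \<le> m" for m
    using lin_comb_eq_of_support[where \<alpha> = \<alpha> and c = c and M = M, OF c that]
    by (simp add: norm_HH_def inner_HH_def L2_inner_def)
  then have "(\<lambda>m. norm_HH \<alpha> (lin_comb \<alpha> c M - lin_comb \<alpha> c m)) \<longlonglongrightarrow> 0"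
    by (intro tendsto_eventually eventually_sequentiallyI[of M])
  then show "c 0 = 0 \<and> (\<lambda>m. norm_HH \<alpha> (lin_comb \<alpha> c M - lin_comb \<alpha> c m)) \<longlonglongrightarrow> 0"
    using c by auto
next
  fix d assume d: "d 0 = 0 \<and> (\<lambda>m. norm_HH \<alpha> (lin_comb \<alpha> c M - lin_comb \<alpha> d m)) \<longlonglongrightarrow> 0"
  show "d = c"
  proof
    fix j
    show "d j = c j"
    proof (cases "j = 0")
      case True
      then show ?thesis
        using c d by auto
    next
      case False
      then have j: "1 \<le> j"
        by simp
      let ?e = "\<lambda>m. lin_comb \<alpha> c M - lin_comb \<alpha> d m"
      have e: "\<bar>c j - d j\<bar> \<le> norm_HH \<alpha> (?e m) * norm_HH \<alpha> (basis \<alpha> j)" if "max M j \<le> m" for m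
      proof -
        have "form \<alpha> (?e m) (basis \<alpha> j) = form \<alpha> (lin_comb \<alpha> c m) (basis \<alpha> j)
            - form \<alpha> (lin_comb \<alpha> d m) (basis \<alpha> j)"
          using that lin_comb_eq_of_support[where \<alpha> = \<alpha> and c = c and M = M and m = m, OF c]
          by (simp add: form_diff_left lin_comb_in_HH basis_in_HH \<alpha>)
        then have "\<bar>form \<alpha> (?e m) (basis \<alpha> j)\<bar> = \<bar>c j - d j\<bar>"
          using that by (simp add: form_lin_comb_basis[OF \<alpha> j] abs_minus_commute)
        then show ?thesis
          using form_bounded[of "?e m" \<alpha> "basis \<alpha> j"]
          by (simp add: HH_diff lin_comb_in_HH basis_in_HH \<alpha>)
      qed
      have "(\<lambda>m. norm_HH \<alpha> (?e m) * norm_HH \<alpha> (basis \<alpha> j)) \<longlonglongrightarrow> 0"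
        using d by (intro tendsto_mult_left_zero) simp
      then have "\<bar>c j - d j\<bar> \<le> 0"
        using e by (intro tendsto_lowerbound[where F = sequentially])
          (auto intro!: eventually_sequentiallyI[of "max M j"])
      then show ?thesis
        by simp
    qed
  qed
qed

lemma Proj_lin_comb:
  assumes "0 < \<alpha>" "\<alpha> < 1" "{j. c j \<noteq> 0} \<subseteq> {1..M}"
  shows "Proj \<alpha> m (lin_comb \<alpha> c M) = lin_comb \<alpha> c m"
  unfolding Proj_def using coords_lin_comb[OF assms] by simp

text \<open>The error involves only basis vectors with index above \<open>m\<close>, and these are orthogonal to \<open>X \<alpha> m\<close>
  for the form.\<close>

lemma Proj_lin_comb_Galerkin:
  assumes \<alpha>: "0 < \<alpha>" "\<alpha> < 1" and c: "{j. c j \<noteq> 0} \<subseteq> {1..M}"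
  shows "is_Galerkin_projection \<alpha> m (lin_comb \<alpha> c M) (Proj \<alpha> m (lin_comb \<alpha> c M))"
  unfolding is_Galerkin_projection_def Proj_lin_comb[OF \<alpha> c]
proof (intro conjI ballI)
  show "lin_comb \<alpha> c m \<in> X \<alpha> m"
    by (auto simp: X_def)
  fix V assume "V \<in> X \<alpha> m"
  then obtain d where V: "V = lin_comb \<alpha> d m"
    by (auto simp: X_def)
  let ?E = "lin_comb \<alpha> c M - lin_comb \<alpha> c m"
  have E: "?E \<in> HH \<alpha>"
    by (intro HH_diff lin_comb_in_HH \<alpha>)
  have "form \<alpha> ?E (basis \<alpha> j) = 0" if "j \<in> {1..m}" for j
    using that c
    by (auto simp: subset_eq form_diff_left lin_comb_in_HH basis_in_HH form_lin_comb_basis \<alpha>)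
  then have "form \<alpha> V ?E = 0"
    unfolding V lin_comb_def[of \<alpha> d m]
    by (subst form_sum_left)
      (auto intro!: HH_scale basis_in_HH \<alpha> E simp: form_scale_left form_commute[of \<alpha> _ ?E])
  then show "form \<alpha> ?E V = 0"
    by (simp add: form_commute)
qed

text \<open>No basis vector is short: on the period the weight is at most 1, so the inverse weight only
  enlarges the second component beyond its unweighted norm.\<close>

lemma norm_HH_basis_ge:
  assumes \<alpha>: "0 < \<alpha>" "\<alpha> < 1" and "1 \<le> j"
  shows "1 / 2 \<le> (norm_HH \<alpha> (basis \<alpha> j))\<^sup>2"
proof -
  define n :: nat where "n = (j + 1) div 2"
  define s :: real where "s = (if odd j then 1 else - 1)"
  have n: "1 \<le> n"
    using assms(3) by (simp add: n_def)
  have int_trig: "has_bochner_integral torus (\<lambda>t. (trig n t)\<^sup>2) 1"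
    using trig_orthonormal[OF n n] by (simp add: power2_eq_square)
  have "1 = (\<integral>t. (trig n t)\<^sup>2 \<partial>torus)"
    using int_trig by (simp add: has_bochner_integral_iff)
  also have "\<dots> \<le> (\<integral>t. weight \<alpha> t * (dual_trig \<alpha> n t)\<^sup>2 \<partial>torus)"
  proof (rule integral_mono_AE)
    show "integrable torus (\<lambda>t. (trig n t)\<^sup>2)"
      using int_trig by (simp add: has_bochner_integral_iff)
    show "AE t in torus. (trig n t)\<^sup>2 \<le> weight \<alpha> t * (dual_trig \<alpha> n t)\<^sup>2"
      using AE_torus
    proof eventually_elim
      case (elim t)
      then have "0 < weight \<alpha> t" "weight \<alpha> t \<le> 1"
        using \<alpha> by (auto intro: weight_pos weight_le_1)
      then show ?case
        by (simp add: weight_dual_trig_square le_divide_eq mult_left_le)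
    qed
  qed (rule integrable_dual_trig_square[OF \<alpha>(2)])
  also have "\<dots> = L2_inner (wtorus \<alpha>) (dual_trig \<alpha> n) (dual_trig \<alpha> n)"
    by (subst L2_inner_wtorus) (auto simp: power2_eq_square)
  finally have dual: "1 \<le> L2_inner (wtorus \<alpha>) (dual_trig \<alpha> n) (dual_trig \<alpha> n)" .
  have "0 \<le> L2_inner (wtorus \<alpha>) (trig n) (trig n)"
    by (simp add: L2_inner_def)
  moreover have "s * s = 1"
    by (simp add: s_def)
  moreover have "(norm_HH \<alpha> (basis \<alpha> j))\<^sup>2 = inner_HH \<alpha> (basis \<alpha> j) (basis \<alpha> j)"
    by (simp add: norm_HH_def inner_HH_nonneg)
  moreover have "\<dots> = 1 / sqrt 2 * (1 / sqrt 2 * L2_inner (wtorus \<alpha>) (trig n) (trig n))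
      + s / sqrt 2 * (s / sqrt 2 * L2_inner (wtorus \<alpha>) (dual_trig \<alpha> n) (dual_trig \<alpha> n))"
    unfolding inner_HH_def basis_eq n_def[symmetric] s_def[symmetric] fst_conv snd_conv
      L2_inner_cmult_left L2_inner_cmult_right ..
  ultimately show ?thesis
    using dual by (simp flip: mult.assoc)
qed

lemma tail_term_lin_comb:
  assumes \<alpha>: "0 < \<alpha>" "\<alpha> < 1" and c: "{j. c j \<noteq> 0} \<subseteq> {1..M}"
  shows "tail_term \<alpha> (lin_comb \<alpha> c M) m = (c (Suc m))\<^sup>2 * (norm_HH \<alpha> (basis \<alpha> (Suc m)))\<^sup>2"
proof -
  let ?V = "scale (c (Suc m)) (basis \<alpha> (Suc m))"
  have "Proj \<alpha> (Suc m) (lin_comb \<alpha> c M) - Proj \<alpha> m (lin_comb \<alpha> c M) = ?V"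
    unfolding Proj_lin_comb[OF \<alpha> c] by (simp add: lin_comb_def)
  then have "tail_term \<alpha> (lin_comb \<alpha> c M) m = inner_HH \<alpha> ?V ?V"
    by (simp add: tail_term_def norm_HH_def inner_HH_nonneg)
  also have "\<dots> = c (Suc m) * (c (Suc m) * inner_HH \<alpha> (basis \<alpha> (Suc m)) (basis \<alpha> (Suc m)))"
    by (simp only: inner_HH_scale_left inner_HH_commute[of \<alpha> "basis \<alpha> (Suc m)" ?V])
  finally show ?thesis
    by (simp add: norm_HH_def inner_HH_nonneg power2_eq_square)
qed

text \<open>The increments of the partial sums are the terms \<open>c j\<close> times \<open>basis \<alpha> j\<close>, so the tail sum is at
  least half the square sum of the coordinates, irrespective of cancellation in the vector itself.\<close>

lemma tail_sum_lin_comb: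
  assumes \<alpha>: "0 < \<alpha>" "\<alpha> < 1" and c: "{j. c j \<noteq> 0} \<subseteq> {1..M}"
  shows "summable (tail_term \<alpha> (lin_comb \<alpha> c M))"
    and "(\<Sum>j=1..M. (c j)\<^sup>2) / 2 \<le> (\<Sum>m. tail_term \<alpha> (lin_comb \<alpha> c M) m)"
proof -
  let ?T = "tail_term \<alpha> (lin_comb \<alpha> c M)"
  note T = tail_term_lin_comb[OF \<alpha> c]
  have "?T sums (\<Sum>m<M. ?T m)"
    by (rule sums_finite) (use c in \<open>auto simp: T subset_eq\<close>)
  then show "summable ?T"
    by (rule sums_summable)
  have "(\<Sum>j=1..M. (c j)\<^sup>2) / 2 = (\<Sum>m<M. (c (Suc m))\<^sup>2 * (1 / 2))"
    by (simp add: sum.atLeast1_atMost_eq sum_divide_distrib)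
  also have "\<dots> \<le> (\<Sum>m<M. ?T m)"
    unfolding T by (intro sum_mono mult_left_mono norm_HH_basis_ge \<alpha>) auto
  also have "\<dots> = suminf ?T"
    using \<open>?T sums _\<close> by (rule sums_unique)
  finally show "(\<Sum>j=1..M. (c j)\<^sup>2) / 2 \<le> suminf ?T" .
qed

text \<open>A nonzero coordinate is detected by the bounded form. The bound below on the tail ratio
  relies on this, since a quotient with denominator 0 is 0.\<close>

lemma norm_HH_lin_comb_pos:
  assumes \<alpha>: "0 < \<alpha>" "\<alpha> < 1" and j: "1 \<le> j" "j \<le> M" "c j \<noteq> 0"
  shows "0 < norm_HH \<alpha> (lin_comb \<alpha> c M)"
proof (rule ccontr)
  assume "\<not> 0 < norm_HH \<alpha> (lin_comb \<alpha> c M)"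
  then have "norm_HH \<alpha> (lin_comb \<alpha> c M) = 0"
    by (simp add: norm_HH_def not_less order.antisym inner_HH_nonneg)
  then have "form \<alpha> (lin_comb \<alpha> c M) (basis \<alpha> j) = 0"
    using form_bounded[OF lin_comb_in_HH[OF \<alpha>] basis_in_HH[OF \<alpha>], of c M j] by simp
  then show False
    using j by (simp add: form_lin_comb_basis[OF \<alpha> j(1)] split: if_splits)
qed

section \<open>Pairs with vanishing second component\<close>

lemma sum_pairs:
  fixes g :: "nat \<Rightarrow> 'a::comm_monoid_add"
  shows "(\<Sum>j=1..2 * K. g j) = (\<Sum>n=1..K. g (2 * n - 1) + g (2 * n))"
  by (induction K) (simp_all add: add.assoc)

text \<open>Since \<open>basis \<alpha> (2 * n - 1) + basis \<alpha> (2 * n)\<close> is \<open>sqrt 2\<close> times \<open>(trig n, 0)\<close>, these are the coordinates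
  of the pair \<open>(u, 0)\<close> whose first component \<open>u\<close> has trigonometric coefficients \<open>a\<close> up to index \<open>K\<close>.\<close>

definition doubled_coeffs :: "(nat \<Rightarrow> real) \<Rightarrow> nat \<Rightarrow> nat \<Rightarrow> real" where
  "doubled_coeffs a K j = (if j \<in> {1..2 * K} then a ((j + 1) div 2) / sqrt 2 else 0)"

lemma sum_fun_apply: "sum f A x = (\<Sum>i\<in>A. f i x)"
  by (induction A rule: infinite_finite_induct) auto

lemma lin_comb_doubled_coeffs:
  "lin_comb \<alpha> (doubled_coeffs a K) (2 * K) = (\<lambda>t. \<Sum>n=1..K. a n * trig n t, \<lambda>t. 0)"
proof -
  have pair: "scale (doubled_coeffs a K (2 * n - 1)) (basis \<alpha> (2 * n - 1))
      + scale (doubled_coeffs a K (2 * n)) (basis \<alpha> (2 * n)) = (\<lambda>t. a n * trig n t, \<lambda>t. 0)"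
    if "n \<in> {1..K}" for n
  proof -
    have "(2 * n - 1 + 1) div 2 = n" "(2 * n + 1) div 2 = n" "odd (2 * n - 1)" "even (2 * n)"
      "2 * n - 1 \<in> {1..2 * K}" "2 * n \<in> {1..2 * K}"
      using that by auto
    then show ?thesis
      unfolding doubled_coeffs_def basis_eq scale_def
      by (simp add: fun_eq_iff del: One_nat_def)
  qed
  have "lin_comb \<alpha> (doubled_coeffs a K) (2 * K) = (\<Sum>n=1..K. (\<lambda>t. a n * trig n t, \<lambda>t. 0))"
    unfolding lin_comb_def sum_pairs by (intro sum.cong refl pair)
  then show ?thesis
    by (simp add: prod_eq_iff fun_eq_iff fst_sum snd_sum sum_fun_apply)
qed

text \<open>Each coefficient is split evenly over two coordinates with factor \<open>1 / sqrt 2\<close>, which preserves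
  the square sum.\<close>

lemma sum_doubled_coeffs_square: "(\<Sum>j=1..2 * K. (doubled_coeffs a K j)\<^sup>2) = (\<Sum>n=1..K. (a n)\<^sup>2)"
  unfolding sum_pairs
proof (intro sum.cong refl)
  fix n assume "n \<in> {1..K}"
  then have "(2 * n - 1 + 1) div 2 = n" "(2 * n + 1) div 2 = n"
    "2 * n - 1 \<in> {1..2 * K}" "2 * n \<in> {1..2 * K}"
    by auto
  then show "(doubled_coeffs a K (2 * n - 1))\<^sup>2 + (doubled_coeffs a K (2 * n))\<^sup>2 = (a n)\<^sup>2"
    unfolding doubled_coeffs_def by (simp add: power_divide del: One_nat_def)
qed

section \<open>Square integrals of the Fejer kernel\<close>

definition fejer_coeff :: "nat \<Rightarrow> nat \<Rightarrow> real" where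
  "fejer_coeff N n = (if n = 1 then 1 else if even n then sqrt 2 * (1 - real (n div 2) / real N) else 0)"

lemma sum_symmetric_int:
  fixes g :: "int \<Rightarrow> real"
  assumes "\<And>k. g (- k) = g k" "1 \<le> N"
  shows "(\<Sum>k\<in>{k. \<bar>k\<bar> < int N}. g k) = g 0 + 2 * (\<Sum>k=1..<N. g (int k))"
  using assms(2)
proof (induction N rule: nat_induct_at_least)
  case base
  have "{k. \<bar>k\<bar> < int 1} = {0}"
    by auto
  then show ?case
    by simp
next
  case (Suc N)
  have "{k. \<bar>k\<bar> < int (Suc N)} = insert (int N) (insert (- int N) {k. \<bar>k\<bar> < int N})"
    by auto
  moreover have "finite {k. \<bar>k\<bar> < int N}"
    by (rule finite_subset[of _ "{- int N..int N}"]) auto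
  ultimately show ?case
    using Suc by (simp add: assms(1))
qed

lemma fejer_cos:
  assumes "1 \<le> N"
  shows "fejer N t = 1 + 2 * (\<Sum>k=1..<N. (1 - real k / real N) * cos (2 * pi * real k * t))"
proof -
  define g where "g k = (1 - \<bar>real_of_int k\<bar> / real N) * cos (2 * pi * real_of_int k * t)" for k
  have Re_term: "Re (complex_of_real r * exp (2 * complex_of_real pi * \<i> * of_int k * complex_of_real t))
      = r * cos (2 * pi * real_of_int k * t)" for r k
    by (simp add: Re_exp)
  have "fejer N t = (\<Sum>k\<in>{k. \<bar>k\<bar> < int N}. g k)"
    unfolding fejer_def g_def by (simp only: Re_sum Re_term)
  also have "\<dots> = g 0 + 2 * (\<Sum>k=1..<N. g (int k))"
    by (rule sum_symmetric_int[OF _ assms]) (simp add: g_def)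
  finally show ?thesis
    by (simp add: g_def)
qed

lemma sum_even_odd:
  fixes g :: "nat \<Rightarrow> 'a::comm_monoid_add"
  assumes "1 \<le> N"
  shows "(\<Sum>n=1..2 * N - 1. g n) = g 1 + (\<Sum>k=1..<N. g (2 * k) + g (2 * k + 1))"
  using assms
proof (induction N rule: nat_induct_at_least)
  case (Suc N)
  have "{1..2 * Suc N - 1} = insert (2 * N + 1) (insert (2 * N) {1..2 * N - 1})"
    using Suc.hyps by auto
  then have "(\<Sum>n=1..2 * Suc N - 1. g n) = g (2 * N + 1) + (g (2 * N) + (\<Sum>n=1..2 * N - 1. g n))"
    using Suc.hyps by (simp del: One_nat_def)
  then show ?case
    using Suc by (simp add: ac_simps)
qed simp

lemma fejer_trig:
  assumes "1 \<le> N"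
  shows "fejer N t = (\<Sum>n=1..2 * N - 1. fejer_coeff N n * trig n t)"
proof -
  have "fejer_coeff N (2 * k) * trig (2 * k) t + fejer_coeff N (2 * k + 1) * trig (2 * k + 1) t
      = 2 * ((1 - real k / real N) * cos (2 * pi * real k * t))" if "k \<in> {1..<N}" for k
    using that by (auto simp: fejer_coeff_def trig_def)
  then have "(\<Sum>k=1..<N. fejer_coeff N (2 * k) * trig (2 * k) t
        + fejer_coeff N (2 * k + 1) * trig (2 * k + 1) t)
      = (\<Sum>k=1..<N. 2 * ((1 - real k / real N) * cos (2 * pi * real k * t)))"
    by (intro sum.cong refl)
  moreover have "fejer_coeff N 1 * trig 1 t = 1"
    by (simp add: fejer_coeff_def trig_def)
  ultimately show ?thesis
    by (simp only: sum_even_odd[OF assms] fejer_cos[OF assms] sum_distrib_left)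
qed

lemma sum_fejer_coeff_square:
  assumes "1 \<le> N"
  shows "(\<Sum>n=1..2 * N - 1. (fejer_coeff N n)\<^sup>2) = (2 * (real N)\<^sup>2 + 1) / (3 * real N)"
proof -
  have "(fejer_coeff N (2 * k))\<^sup>2 + (fejer_coeff N (2 * k + 1))\<^sup>2 = 2 * (real N - real k)\<^sup>2 / (real N)\<^sup>2"
    if "k \<in> {1..<N}" for k
  proof -
    have "1 - real k / real N = (real N - real k) / real N"
      using assms by (simp add: diff_divide_distrib)
    then show ?thesis
      using that by (auto simp: fejer_coeff_def power_mult_distrib power_divide)
  qed
  then have "(\<Sum>n=1..2 * N - 1. (fejer_coeff N n)\<^sup>2)
      = 1 + (\<Sum>k=1..<N. 2 * (real N - real k)\<^sup>2) / (real N)\<^sup>2"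
    unfolding sum_even_odd[OF assms] sum_divide_distrib by (simp add: fejer_coeff_def)
  \<comment> \<open>The induction needs the minuend \<open>x\<close> to be independent of \<open>N\<close>.\<close>
  also have "(\<Sum>k=1..<N. 2 * (x - real k)\<^sup>2)
      = 2 * (real N - 1) * x\<^sup>2 - 2 * x * (real N - 1) * real N
        + (real N - 1) * real N * (2 * real N - 1) / 3" for x
    using assms
    by (induction N rule: nat_induct_at_least) (simp_all add: field_simps power2_eq_square)
  also have "1 + (2 * (real N - 1) * (real N)\<^sup>2 - 2 * real N * (real N - 1) * real N
        + (real N - 1) * real N * (2 * real N - 1) / 3) / (real N)\<^sup>2
      = (2 * (real N)\<^sup>2 + 1) / (3 * real N)"
    using assms by (simp add: field_simps power2_eq_square)
  finally show ?thesis .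
qed

lemma fejer_square_integral:
  assumes "1 \<le> N"
  shows "has_bochner_integral torus (\<lambda>t. (fejer N t)\<^sup>2) ((2 * (real N)\<^sup>2 + 1) / (3 * real N))"
proof -
  have "has_bochner_integral torus (\<lambda>t. (\<Sum>n=1..2 * N - 1. fejer_coeff N n * trig n t)\<^sup>2)
      (1 * (\<Sum>n=1..2 * N - 1. (fejer_coeff N n)\<^sup>2))"
    by (intro has_bochner_integral_square_of_orthogonal_sum trig_orthonormal) auto
  then show ?thesis
    using assms by (simp only: fejer_trig sum_fejer_coeff_square mult_1)
qed

text \<open>The triangular Fejer coefficients have constant differences \<open>1 / N\<close>. Multiplication by
  \<open>sin (pi * t)\<close> takes differences, so it turns the kernel into a sum of \<open>N\<close> sines of half-integer
  frequency with equal coefficients. Summation by parts makes this precise.\<close>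

lemma sin_times_fejer:
  assumes "1 \<le> N"
  shows "sin (pi * t) * fejer N t = (\<Sum>k=1..N. 1 / real N * sin (pi * (2 * real k - 1) * t))"
proof -
  define s where "s k = sin (pi * (2 * real k - 1) * t)" for k :: nat
  have s: "2 * (sin (pi * t) * cos (2 * pi * real k * t)) = s (Suc k) - s k" for k
    unfolding sin_times_cos s_def by (simp add: algebra_simps sin_diff sin_add)
  have "real N * (sin (pi * t) * fejer N t)
      = real N * sin (pi * t)
        + (\<Sum>k=1..<N. (real N - real k) * (2 * (sin (pi * t) * cos (2 * pi * real k * t))))"
  proof -
    have "real N * (1 - real k / real N) = real N - real k" for k
      using assms by (simp add: field_simps)
    moreover have "real N * (sin (pi * t) * (1 + 2 * (\<Sum>k=1..<N. a k * b k)))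
        = real N * sin (pi * t) + (\<Sum>k=1..<N. (real N * a k) * (2 * (sin (pi * t) * b k)))" for a b
      by (simp add: distrib_left sum_distrib_left mult_ac)
    ultimately show ?thesis
      by (simp only: fejer_cos[OF assms])
  qed
  also have "\<dots> = real N * s 1 + (\<Sum>k=1..<N. (real N - real k) * (s (Suc k) - s k))"
    unfolding s by (simp add: s_def)
  also have "\<dots> = (\<Sum>k=1..N. s k)"
  proof -
    \<comment> \<open>The minuend is generalised to \<open>x\<close> for the induction; the last term vanishes at \<open>x = N\<close>.\<close>
    have "x * s 1 + (\<Sum>k=1..<N. (x - real k) * (s (Suc k) - s k)) = (\<Sum>k=1..N. s k) + (x - real N) * s N" for x
      using assms
      by (induction N rule: nat_induct_at_least) (simp_all add: algebra_simps)
    from this[of "real N"] show ?thesis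
      by simp
  qed
  finally have "real N * (sin (pi * t) * fejer N t) = (\<Sum>k=1..N. s k)" .
  then have "sin (pi * t) * fejer N t = (\<Sum>k=1..N. s k) / real N"
    using assms by (simp add: field_simps)
  then show ?thesis
    by (simp add: s_def sum_divide_distrib)
qed

section \<open>The weighted norm of the Fejer kernel\<close>

lemma Jordan_sin_ineq:
  assumes "0 \<le> t" "t \<le> 1/2"
  shows "2 * t \<le> sin (pi * t)"
proof -
  have "convex_on {0..pi/2} (\<lambda>x. - sin x)"
  proof (rule f''_ge0_imp_convex)
    show "((\<lambda>x. - sin x) has_real_derivative - cos x) (at x)" for x :: real
      by (auto intro!: derivative_eq_intros)
    show "((\<lambda>x. - cos x) has_real_derivative sin x) (at x)" for x :: real
      by (auto intro!: derivative_eq_intros)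
    show "0 \<le> sin x" if "x \<in> {0..pi/2}" for x :: real
      using that by (intro sin_ge_zero) auto
  qed simp
  from convex_onD[OF this, of "2 * t" 0 "pi/2"] show ?thesis
    using assms by (simp add: mult.commute)
qed

lemma square_le_sin_square:
  assumes "\<bar>t\<bar> \<le> 1/2"
  shows "4 * t\<^sup>2 \<le> (sin (pi * t))\<^sup>2"
proof -
  have "(2 * \<bar>t\<bar>)\<^sup>2 \<le> (sin (pi * \<bar>t\<bar>))\<^sup>2"
    using assms by (intro power_mono Jordan_sin_ineq) auto
  moreover have "(sin (pi * \<bar>t\<bar>))\<^sup>2 = (sin (pi * t))\<^sup>2"
    by (simp add: abs_if)
  ultimately show ?thesis
    by (simp add: power_mult_distrib)
qed

text \<open>Sines of half-integer frequency are not 1-periodic, but products of two of them are, and they are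
  orthogonal with square norm \<open>1/2\<close>. The integral is thus \<open>N\<close> times \<open>(1 / N)\<^sup>2 / 2\<close>: the factor
  \<open>sin (pi * t)\<close> gains \<open>1 / N\<^sup>2\<close> over the square norm of the kernel, which has order \<open>N\<close>.\<close>

lemma sin_fejer_square_integral:
  assumes "1 \<le> N"
  shows "has_bochner_integral torus (\<lambda>t. (sin (pi * t) * fejer N t)\<^sup>2) (1 / (2 * real N))"
proof -
  define e where "e k t = sin (pi * (2 * real k - 1) * t)" for k :: nat and t
  have orth: "has_bochner_integral torus (\<lambda>t. e j t * e k t) (if j = k then 1/2 else 0)"
    if "j \<in> {1..N}" "k \<in> {1..N}" for j k
  proof -
    have *: "e j t * e k t =
        (cos (2 * pi * of_int (int j - int k) * t) - cos (2 * pi * of_int (int j + int k - 1) * t)) / 2"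
      for t
    proof -
      have "pi * (2 * real j - 1) * t - pi * (2 * real k - 1) * t = 2 * pi * of_int (int j - int k) * t"
        "pi * (2 * real j - 1) * t + pi * (2 * real k - 1) * t = 2 * pi * of_int (int j + int k - 1) * t"
        by (simp_all add: algebra_simps)
      then show ?thesis
        by (simp only: e_def sin_times_sin)
    qed
    have "int j + int k - 1 \<noteq> 0" "(int j - int k = 0) = (j = k)"
      using that by auto
    then have integral_eq: "((if int j - int k = 0 then 1 else 0) - (if int j + int k - 1 = 0 then 1 else 0)) / 2
        = (if j = k then 1/2 else 0 :: real)"
      by simp
    show ?thesis
      using has_bochner_integral_torus_half_diff[OF has_bochner_integral_torus_cos[of "int j - int k"]
          has_bochner_integral_torus_cos[of "int j + int k - 1"]]
      unfolding * integral_eq .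
  qed
  have "has_bochner_integral torus (\<lambda>t. (\<Sum>k=1..N. 1 / real N * e k t)\<^sup>2)
      (1/2 * (\<Sum>k=1..N. (1 / real N)\<^sup>2))"
    by (intro has_bochner_integral_square_of_orthogonal_sum orth) auto
  moreover have "1/2 * (\<Sum>k=1..N. (1 / real N)\<^sup>2) = 1 / (2 * real N)"
    using assms by (simp add: power2_eq_square)
  ultimately show ?thesis
    by (simp only: sin_times_fejer[OF assms] e_def)
qed

text \<open>With \<open>s = N * \<bar>t\<bar>\<close> this is \<open>s powr \<alpha> \<le> 1 + s\<^sup>2\<close>, scaled. Beyond a constant
  it leaves only \<open>t\<^sup>2\<close>, bounded by \<open>(sin (pi * t))\<^sup>2\<close>, a factor that acts simply on Fourier series.\<close>

lemma weight_le_quadratic: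
  assumes "0 < \<alpha>" "\<alpha> < 1" "1 \<le> N"
  shows "weight \<alpha> t \<le> real N powr (- \<alpha>) * (1 + (real N)\<^sup>2 * t\<^sup>2)"
proof -
  define s where "s = real N * \<bar>t\<bar>"
  have s: "0 \<le> s"
    by (simp add: s_def)
  have "s powr \<alpha> \<le> 1 + s\<^sup>2"
  proof (cases "s \<le> 1")
    case True
    then have "s powr \<alpha> \<le> 1"
      using s assms by (intro powr_le1) auto
    then show ?thesis
      by (simp add: add_increasing2)
  next
    case False
    then have "s powr \<alpha> \<le> s powr 2"
      using assms by (intro powr_mono) auto
    then show ?thesis
      using False by (simp add: powr_numeral)
  qed
  then have "real N powr (- \<alpha>) * s powr \<alpha> \<le> real N powr (- \<alpha>) * (1 + s\<^sup>2)"
    by (intro mult_left_mono) auto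
  moreover have "real N powr (- \<alpha>) * s powr \<alpha> = weight \<alpha> t"
    using assms by (simp add: s_def weight_def powr_mult powr_minus field_simps)
  ultimately show ?thesis
    by (simp add: s_def power_mult_distrib)
qed

lemma fejer_measurable [measurable]: "1 \<le> N \<Longrightarrow> fejer N \<in> borel_measurable borel"
proof -
  assume "1 \<le> N"
  then have "fejer N = (\<lambda>t. \<Sum>n=1..2 * N - 1. fejer_coeff N n * trig n t)"
    by (intro ext fejer_trig)
  then show "fejer N \<in> borel_measurable borel"
    by simp
qed

text \<open>The kernel concentrates at scale \<open>1 / N\<close>, where the weight has size \<open>N powr - \<alpha>\<close>. Concentration
  enters only through the second moment, bounded by means of \<open>4 * t\<^sup>2 \<le> (sin (pi * t))\<^sup>2\<close>.\<close>

lemma fejer_weighted_square_integral: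
  assumes \<alpha>: "0 < \<alpha>" "\<alpha> < 1" and N: "1 \<le> N"
  shows "(\<integral>t. weight \<alpha> t * (fejer N t)\<^sup>2 \<partial>torus)
    \<le> 2 * real N powr (- \<alpha>) * (\<integral>t. (fejer N t)\<^sup>2 \<partial>torus)"
proof -
  let ?A = "(2 * (real N)\<^sup>2 + 1) / (3 * real N)"
  let ?g = "\<lambda>t. real N powr (- \<alpha>) * ((fejer N t)\<^sup>2 + (real N)\<^sup>2 / 4 * (sin (pi * t) * fejer N t)\<^sup>2)"
  have g: "has_bochner_integral torus ?g
      (real N powr (- \<alpha>) * (?A + (real N)\<^sup>2 / 4 * (1 / (2 * real N))))"
    by (intro has_bochner_integral_mult_right has_bochner_integral_add
        fejer_square_integral sin_fejer_square_integral N)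
  have bound: "AE t in torus. weight \<alpha> t * (fejer N t)\<^sup>2 \<le> ?g t"
    using AE_torus
  proof eventually_elim
    case (elim t)
    then have "4 * t\<^sup>2 \<le> (sin (pi * t))\<^sup>2"
      by (intro square_le_sin_square) auto
    then have "(real N)\<^sup>2 * t\<^sup>2 \<le> (real N)\<^sup>2 / 4 * (sin (pi * t))\<^sup>2"
      using mult_left_mono[of "4 * t\<^sup>2" "(sin (pi * t))\<^sup>2" "(real N)\<^sup>2"] by simp
    then have "weight \<alpha> t \<le> real N powr (- \<alpha>) * (1 + (real N)\<^sup>2 / 4 * (sin (pi * t))\<^sup>2)"
      by (intro order.trans[OF weight_le_quadratic[OF \<alpha> N]] mult_left_mono) auto
    then have "weight \<alpha> t * (fejer N t)\<^sup>2
        \<le> real N powr (- \<alpha>) * (1 + (real N)\<^sup>2 / 4 * (sin (pi * t))\<^sup>2) * (fejer N t)\<^sup>2"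
      by (rule mult_right_mono) simp
    also have "\<dots> = ?g t"
      by (simp add: algebra_simps power_mult_distrib)
    finally show ?case .
  qed
  have "(\<integral>t. weight \<alpha> t * (fejer N t)\<^sup>2 \<partial>torus) \<le> (\<integral>t. ?g t \<partial>torus)"
  proof (rule integral_mono_AE'[OF _ bound])
    show "integrable torus ?g"
      using g by (simp only: has_bochner_integral_iff)
  qed (simp add: weight_nonneg)
  also have "\<dots> = real N powr (- \<alpha>) * (?A + real N / 8)"
    using g N by (simp add: has_bochner_integral_iff power2_eq_square)
  also have "\<dots> \<le> real N powr (- \<alpha>) * (2 * ?A)"
  proof (rule mult_left_mono)
    show "?A + real N / 8 \<le> 2 * ?A"
      using N by (simp add: field_simps power2_eq_square)
  qed simp
  also have "?A = (\<integral>t. (fejer N t)\<^sup>2 \<partial>torus)"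
    using fejer_square_integral[OF N] by (simp add: has_bochner_integral_iff)
  finally show ?thesis
    by (simp add: mult_ac)
qed

section \<open>Unboundedness of the tail ratios\<close>

definition target_coeff :: "nat \<Rightarrow> nat \<Rightarrow> real" where
  "target_coeff N n = fejer_coeff N n / L2_norm torus (fejer N)"

lemma L2_norm_fejer:
  assumes "1 \<le> N"
  shows "(L2_norm torus (fejer N))\<^sup>2 = (\<integral>t. (fejer N t)\<^sup>2 \<partial>torus)"
    and "(\<integral>t. (fejer N t)\<^sup>2 \<partial>torus) = (\<Sum>n=1..2 * N - 1. (fejer_coeff N n)\<^sup>2)"
    and "0 < L2_norm torus (fejer N)"
proof -
  have I: "(\<integral>t. (fejer N t)\<^sup>2 \<partial>torus) = (2 * (real N)\<^sup>2 + 1) / (3 * real N)"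
    using fejer_square_integral[OF assms] by (simp add: has_bochner_integral_iff)
  then show "(\<integral>t. (fejer N t)\<^sup>2 \<partial>torus) = (\<Sum>n=1..2 * N - 1. (fejer_coeff N n)\<^sup>2)"
    by (simp only: I sum_fejer_coeff_square[OF assms])
  have "0 < (\<integral>t. (fejer N t)\<^sup>2 \<partial>torus)"
    unfolding I using assms by (intro divide_pos_pos add_nonneg_pos) auto
  then show "(L2_norm torus (fejer N))\<^sup>2 = (\<integral>t. (fejer N t)\<^sup>2 \<partial>torus)"
    "0 < L2_norm torus (fejer N)"
    by (simp_all add: L2_norm_def L2_inner_def power2_eq_square[symmetric])
qed

lemma target_eq_lin_comb:
  assumes "1 \<le> N"
  shows "target N = lin_comb \<alpha> (doubled_coeffs (target_coeff N) (2 * N - 1)) (2 * (2 * N - 1))"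
  unfolding lin_comb_doubled_coeffs
  by (simp add: target_def q_def[abs_def] fejer_trig[OF assms] target_coeff_def sum_divide_distrib)

lemma sum_target_coeff_square:
  assumes "1 \<le> N"
  shows "(\<Sum>n=1..2 * N - 1. (target_coeff N n)\<^sup>2) = 1"
proof -
  have "(\<Sum>n=1..2 * N - 1. (target_coeff N n)\<^sup>2)
      = (\<Sum>n=1..2 * N - 1. (fejer_coeff N n)\<^sup>2) / (L2_norm torus (fejer N))\<^sup>2"
    by (simp add: target_coeff_def power_divide sum_divide_distrib)
  also have "(\<Sum>n=1..2 * N - 1. (fejer_coeff N n)\<^sup>2) = (L2_norm torus (fejer N))\<^sup>2"
    by (simp only: L2_norm_fejer[OF assms])
  finally show ?thesis
    using L2_norm_fejer(3)[OF assms] by simp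
qed

lemma norm_target_le:
  assumes \<alpha>: "0 < \<alpha>" "\<alpha> < 1" and N: "1 \<le> N"
  shows "(norm_HH \<alpha> (target N))\<^sup>2 \<le> 2 * real N powr (- \<alpha>)"
proof -
  define L where "L = L2_norm torus (fejer N)"
  have L: "0 < L" "L\<^sup>2 = (\<integral>t. (fejer N t)\<^sup>2 \<partial>torus)"
    using L2_norm_fejer[OF N] by (simp_all add: L_def)
  have "q N = (\<lambda>t. 1 / L * fejer N t)"
    by (simp add: q_def fun_eq_iff L_def)
  then have "L2_inner (wtorus \<alpha>) (q N) (q N)
      = 1 / L * (1 / L * L2_inner (wtorus \<alpha>) (fejer N) (fejer N))"
    by (simp only: L2_inner_cmult_left L2_inner_cmult_right)
  moreover have "(norm_HH \<alpha> (target N))\<^sup>2 = inner_HH \<alpha> (target N) (target N)"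
    by (simp add: norm_HH_def inner_HH_nonneg)
  moreover have "\<dots> = L2_inner (wtorus \<alpha>) (q N) (q N)"
    by (simp add: inner_HH_def target_def L2_inner_def)
  ultimately have "(norm_HH \<alpha> (target N))\<^sup>2
      = 1 / L * (1 / L * L2_inner (wtorus \<alpha>) (fejer N) (fejer N))"
    by simp
  also have "\<dots> = (\<integral>t. weight \<alpha> t * (fejer N t)\<^sup>2 \<partial>torus) / L\<^sup>2"
    using fejer_measurable[OF N] by (simp add: L2_inner_wtorus power2_eq_square)
  also have "\<dots> \<le> 2 * real N powr (- \<alpha>)"
    using fejer_weighted_square_integral[OF \<alpha> N] L(1) unfolding L(2)[symmetric]
    by (simp add: pos_divide_le_eq)
  finally show ?thesis .
qed

text \<open>The tail sum is at least \<open>1/2\<close> by the normalisation in unweighted \<open>L\<^sup>2\<close>, whereas the squared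
  weighted norm is at most \<open>2 * N powr - \<alpha>\<close>.\<close>

lemma tail_ratio_target_ge:
  assumes \<alpha>: "0 < \<alpha>" "\<alpha> < 1" and N: "1 \<le> N"
  shows "summable (tail_term \<alpha> (target N))"
    and "1 / 4 * real N powr \<alpha> \<le> tail_ratio \<alpha> (target N)"
proof -
  let ?K = "2 * N - 1"
  let ?c = "doubled_coeffs (target_coeff N) ?K"
  note target = target_eq_lin_comb[OF N, of \<alpha>]
  have supp: "{j. ?c j \<noteq> 0} \<subseteq> {1..2 * ?K}"
    by (auto simp: doubled_coeffs_def split: if_splits)
  show "summable (tail_term \<alpha> (target N))"
    unfolding target by (rule tail_sum_lin_comb(1)[OF \<alpha> supp])
  have tail: "1 / 2 \<le> suminf (tail_term \<alpha> (target N))"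
    using tail_sum_lin_comb(2)[OF \<alpha> supp]
    unfolding target sum_doubled_coeffs_square sum_target_coeff_square[OF N] .
  have "?c 1 \<noteq> 0"
    using N L2_norm_fejer(3)[OF N] by (simp add: doubled_coeffs_def target_coeff_def fejer_coeff_def)
  then have pos: "0 < (norm_HH \<alpha> (target N))\<^sup>2"
    unfolding target using N by (intro zero_less_power norm_HH_lin_comb_pos[OF \<alpha>, of 1]) auto
  have "1 / 4 * real N powr \<alpha> = (1 / 2) / (2 * real N powr (- \<alpha>))"
    by (simp add: powr_minus field_simps)
  also have "\<dots> \<le> suminf (tail_term \<alpha> (target N)) / (norm_HH \<alpha> (target N))\<^sup>2"
    using tail norm_target_le[OF \<alpha> N] pos by (intro frac_le) auto
  finally show "1 / 4 * real N powr \<alpha> \<le> tail_ratio \<alpha> (target N)"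
    by (simp add: tail_ratio_def)
qed

theorem theorem6p2:
  fixes \<alpha> :: real
  assumes "0 < \<alpha>" and "\<alpha> < 1"
  shows "(\<forall>N\<ge>2. \<forall>m. is_Galerkin_projection \<alpha> m (target N) (Proj \<alpha> m (target N)))
    \<and> (\<exists>c>0. \<forall>N\<ge>2. summable (tail_term \<alpha> (target N))
            \<and> tail_ratio \<alpha> (target N) \<ge> c * real N powr \<alpha>)
    \<and> (\<forall>N\<ge>2. \<exists>M. target N \<in> X \<alpha> M)
    \<and> \<not> (\<exists>B. \<forall>N\<ge>2. tail_ratio \<alpha> (target N) \<le> B)"
proof (intro conjI)
  show "\<forall>N\<ge>2. \<forall>m. is_Galerkin_projection \<alpha> m (target N) (Proj \<alpha> m (target N))"
  proof (intro allI impI)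
    fix N m :: nat assume "2 \<le> N"
    then have N: "1 \<le> N"
      by simp
    show "is_Galerkin_projection \<alpha> m (target N) (Proj \<alpha> m (target N))"
      unfolding target_eq_lin_comb[OF N, of \<alpha>]
      by (intro Proj_lin_comb_Galerkin assms) (auto simp: doubled_coeffs_def split: if_splits)
  qed
  show "\<exists>c>0. \<forall>N\<ge>2. summable (tail_term \<alpha> (target N)) \<and> tail_ratio \<alpha> (target N) \<ge> c * real N powr \<alpha>"
    using tail_ratio_target_ge[OF assms] by (intro exI[of _ "1 / 4"]) auto
  show "\<forall>N\<ge>2. \<exists>M. target N \<in> X \<alpha> M"
  proof (intro allI impI)
    fix N :: nat assume "2 \<le> N"
    then have "target N = lin_comb \<alpha> (doubled_coeffs (target_coeff N) (2 * N - 1)) (2 * (2 * N - 1))"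
      by (intro target_eq_lin_comb) simp
    then show "\<exists>M. target N \<in> X \<alpha> M"
      unfolding X_def by blast
  qed
  show "\<not> (\<exists>B. \<forall>N\<ge>2. tail_ratio \<alpha> (target N) \<le> B)"
  proof
    assume "\<exists>B. \<forall>N\<ge>2. tail_ratio \<alpha> (target N) \<le> B"
    then obtain B where B: "\<And>N. 2 \<le> N \<Longrightarrow> tail_ratio \<alpha> (target N) \<le> B"
      by blast
    obtain N :: nat where N: "max 2 ((4 * \<bar>B\<bar>) powr (1 / \<alpha>)) < real N"
      using reals_Archimedean2 by blast
    have "4 * \<bar>B\<bar> = ((4 * \<bar>B\<bar>) powr (1 / \<alpha>)) powr \<alpha>"
      using assms(1) by (simp add: powr_powr)
    also have "\<dots> < real N powr \<alpha>"
      using N assms(1) by (intro powr_less_mono2) auto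
    finally have "4 * \<bar>B\<bar> < real N powr \<alpha>" .
    moreover have "2 \<le> N"
      using N by simp
    ultimately show False
      using B[of N] tail_ratio_target_ge(2)[OF assms, of N] by simp
  qed
qed

end
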